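(* Let $S$ be a finite set, $\mu$ a probability mass function on $S$, $r:S\to\mathbb{R}$, and $(P_i(\epsilon):i\ge1,\epsilon>0)$ a family of stochastic matrices on $S$. Assume that the positive integer $n=n(\epsilon)$ is such that $n/\log(1/\epsilon)\to\infty$ and $n=o(\epsilon^{-1/3})$ as $\epsilon\downarrow0$. Suppose that there exist matrices $\tilde P,\tilde P^{(1)}$ (not depending on $\epsilon$) for which $$\sup_{1\le i\le n}\|P_i(\epsilon)-(\tilde P+\epsilon(i-1)\tilde P^{(1)})\|=O(\epsilon^2n^2)$$ as $\epsilon\downarrow0$, where $\tilde P$ is aperiodic and irreducible. Then $$\mu\prod_{j=1}^{n}P_j(\epsilon)\,r=\tilde\pi r+\epsilon n\tilde\pi\tilde P^{(1)}(I-\tilde P+\tilde\Pi)^{-1}r-\epsilon\tilde\pi\tilde P^{(1)}(I-\tilde P+\tilde\Pi)^{-2}r+O(\epsilon^2n^3)$$ as $\epsilon\downarrow0$, where $\tilde\pi$ is the row vector corresponding to the stationary distribution of $\tilde P$, and $\tilde\Pi$ is the rank one matrix with all rows identical to $\tilde\pi$.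
   Context: Matrix products are taken in increasing order of index, $\prod_{j=1}^nP_j=P_1P_2\cdots P_n$. The matrix norm is $\|A\|=\max_x\sum_y|A(x,y)|$. Probability mass functions are row vectors and functions on $S$ are column vectors. *)

theory Defs
  imports "HOL-Analysis.Analysis" "HOL-Library.Landau_Symbols"
begin

definition prob_vector :: "real ^ 's \<Rightarrow> bool" where
  "prob_vector p \<longleftrightarrow> (\<forall>x. 0 \<le> p $ x) \<and> (\<Sum>x\<in>UNIV. p $ x) = 1"

definition stochastic_matrix :: "real ^ 's ^ 's \<Rightarrow> bool" where
  "stochastic_matrix P \<longleftrightarrow> (\<forall>x. prob_vector (P $ x))"

(* The operator norm induced by the sup norm on column vectors. *)
definition row_sum_norm :: "real ^ 's ^ 's \<Rightarrow> real" where
  "row_sum_norm A = Max (range (\<lambda>x. \<Sum>y\<in>UNIV. \<bar>A $ x $ y\<bar>))"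

(* P 1 ** P 2 ** ... ** P n, the indices starting at 1.  The library products cannot be used:
   they need commutativity, and * on the type real ^ 's ^ 's is componentwise. *)
primrec matrix_prod :: "(nat \<Rightarrow> real ^ 's ^ 's) \<Rightarrow> nat \<Rightarrow> real ^ 's ^ 's" where
  "matrix_prod P 0 = mat 1"
| "matrix_prod P (Suc n) = matrix_prod P n ** P (Suc n)"

definition matrix_power :: "real ^ 's ^ 's \<Rightarrow> nat \<Rightarrow> real ^ 's ^ 's" where
  "matrix_power A k = matrix_prod (\<lambda>_. A) k"

definition irreducible_matrix :: "real ^ 's ^ 's \<Rightarrow> bool" where
  "irreducible_matrix P \<longleftrightarrow> (\<forall>x y. \<exists>k>0. matrix_power P k $ x $ y > 0)"

definition aperiodic_matrix :: "real ^ 's ^ 's \<Rightarrow> bool" where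
  "aperiodic_matrix P \<longleftrightarrow> (\<forall>x. Gcd {k. k > 0 \<and> matrix_power P k $ x $ x > 0} = 1)"

(* Meaningful only when exactly one stationary probability vector exists, as is the case
   for an irreducible stochastic matrix. *)
definition stationary_distribution :: "real ^ 's ^ 's \<Rightarrow> real ^ 's" where
  "stationary_distribution P = (THE p. prob_vector p \<and> p v* P = p)"

definition matrix_with_rows :: "real ^ 's \<Rightarrow> real ^ 's ^ 's" where
  "matrix_with_rows p = (\<chi> x. p)"

end

theory Submission
  imports Defs
begin

text \<open>
  Row vectors of zero sum decay geometrically under right multiplication by \<open>P0\<close>, since some
  power of \<open>P0\<close> has positive entries (Doeblin). The hypotheses force \<open>P0\<close> to be stochastic and
  the rows of \<open>P1\<close> to have zero sum, so every perturbation term is damped by this decay. No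
  series expansion is needed: the row vectors \<open>\<nu>\<^sub>m = \<mu> P\<^sub>1 \<dots> P\<^sub>m\<close> satisfy
  \<open>\<nu>\<^sub>m\<^sub>+\<^sub>1 = \<nu>\<^sub>m P0 + \<epsilon> m \<nu>\<^sub>m P1 + O(\<epsilon>\<^sup>2n\<^sup>2)\<close>, which first gives
  \<open>\<nu>\<^sub>m = \<pi> + O(\<rho>\<^sup>m + \<epsilon>n)\<close>. Replacing \<open>\<nu>\<^sub>m\<close> by \<open>\<pi>\<close> in the middle term leaves a
  recursion with an explicit solution, because \<open>\<pi> P1 Z\<close> solves a Poisson equation. The
  remaining terms contain \<open>\<rho>\<^sup>n\<close>, which is \<open>O(\<epsilon>\<^sup>2)\<close> since \<open>n / log (1/\<epsilon>) \<rightarrow> \<infinity>\<close>.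
\<close>

subsection \<open>Primitivity of irreducible aperiodic matrices\<close>

lemma add_closed_mult:
  fixes S :: "nat set"
  assumes "\<And>a b. a \<in> S \<Longrightarrow> b \<in> S \<Longrightarrow> a + b \<in> S" and "a \<in> S" and "0 < k"
  shows "k * a \<in> S"
  using \<open>0 < k\<close>
proof (induction k rule: nat_induct_non_zero)
  case 1
  then show ?case using assms(2) by simp
next
  case (Suc n)
  then show ?case using assms(1,2) by simp
qed

text \<open>The differences of elements of \<open>S\<close> form a subgroup of the integers, so its least positive
  element divides all of \<open>S\<close> and must be 1.\<close>

lemma add_closed_Gcd_1_consecutive:
  fixes S :: "nat set"
  assumes add: "\<And>a b. a \<in> S \<Longrightarrow> b \<in> S \<Longrightarrow> a + b \<in> S"
    and gcd: "Gcd S = 1"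
  shows "\<exists>b\<in>S. b + 1 \<in> S"
proof -
  define D where "D = {d. 0 < d \<and> (\<exists>b\<in>S. b + d \<in> S)}"
  define d where "d = (LEAST d. d \<in> D)"
  obtain s where s: "s \<in> S" "s \<noteq> 0"
    using gcd by (metis Gcd_0_iff insertI1 subsetI zero_neq_one)
  then have "s \<in> D"
    using add[of s s] by (auto simp: D_def)
  then have d: "d \<in> D" and least: "\<And>e. e \<in> D \<Longrightarrow> d \<le> e"
    unfolding d_def by (auto intro: LeastI Least_le)
  then obtain b where b: "b \<in> S" "b + d \<in> S" and "0 < d"
    by (auto simp: D_def)
  have "d dvd t" if t: "t \<in> S" for t
  proof (rule ccontr)
    assume nd: "\<not> d dvd t"
    then have "0 < t mod d" "t mod d < d"
      using \<open>0 < d\<close> by (auto simp: dvd_eq_mod_eq_0)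
    moreover have "t mod d \<in> D"
    \<comment> \<open>Since 0 need not lie in \<open>S\<close>, the multiple \<open>q * b\<close> is
      only available for positive \<open>q\<close>. For \<open>q = 0\<close> the remainder is
      \<open>t\<close> itself, the difference of \<open>t + t\<close> and \<open>t\<close>.\<close>
    proof (cases "t div d = 0")
      case True
      then have "t mod d = t"
        by (metis mult_zero_left mod_div_mult_eq add.right_neutral)
      then show ?thesis
        using t add[OF t t] \<open>0 < t mod d\<close> by (auto simp: D_def)
    next
      case False
      define q where "q = t div d"
      have "q * (b + d) \<in> S" "q * b \<in> S"
        using add_closed_mult[OF add] b False by (auto simp: q_def)
      then have "t + q * (b + d) \<in> S" and qb: "q * b + t \<in> S"
        using add t by auto
      have tq: "t = q * d + t mod d"
        by (simp add: q_def)
      have "q * (b + d) + t mod d = q * b + t"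
        using tq by (simp add: algebra_simps)
      then show ?thesis
        using \<open>q * (b + d) \<in> S\<close> qb \<open>0 < t mod d\<close>
        by (auto simp: D_def intro!: bexI[of _ "q * (b + d)"])
    qed
    ultimately show False
      using least by fastforce
  qed
  then have "d dvd Gcd S"
    by (auto intro: Gcd_greatest)
  then show ?thesis
    using gcd b by auto
qed

text \<open>With \<open>b\<close> and \<open>b + 1\<close> in \<open>S\<close>, division with
  remainder gives \<open>n = q * b + r = (q - r) * b + r * (b + 1)\<close>, a combination of
  elements of \<open>S\<close> once \<open>q\<close> exceeds \<open>r\<close>.\<close>

lemma add_closed_Gcd_1_eventually:
  fixes S :: "nat set"
  assumes add: "\<And>a b. a \<in> S \<Longrightarrow> b \<in> S \<Longrightarrow> a + b \<in> S"
    and gcd: "Gcd S = 1"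
  shows "\<exists>N. \<forall>n\<ge>N. n \<in> S"
proof -
  obtain b where b: "b \<in> S" "b + 1 \<in> S"
    using add_closed_Gcd_1_consecutive[OF assms] by blast
  show ?thesis
  proof (intro exI allI impI)
    \<comment> \<open>This threshold forces the quotient of \<open>n\<close> by \<open>b\<close>
      above \<open>b\<close>, hence above the remainder.\<close>
    fix n assume n: "(b + 1) * (b + 1) \<le> n"
    show "n \<in> S"
    proof (cases "b = 0")
      case True
      then have "n = n * (b + 1)" "0 < n" using n by auto
      then show ?thesis using add_closed_mult[OF add b(2), of n] by simp
    next
      case False
      define q r where "q = n div b" and "r = n mod b"
      have nq: "n = q * b + r" by (simp add: q_def r_def)
      have "r < b" using False by (simp add: r_def)
      have "b < q"
      proof (rule ccontr)
        assume "\<not> b < q"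
        then have "q * b \<le> b * b" by (simp add: mult_right_mono)
        moreover have "(b + 1) * (b + 1) = b * b + 2 * b + 1" by simp
        ultimately show False using n nq \<open>r < b\<close> by linarith
      qed
      then obtain k where k: "q = r + k" "0 < k"
        using \<open>r < b\<close> by (metis less_imp_add_positive less_trans)
      have kb: "k * b \<in> S" using add_closed_mult[OF add b(1)] k by simp
      have "n = k * b + r * (b + 1)" using nq k by (simp add: algebra_simps)
      then show ?thesis
        using kb add[OF kb add_closed_mult[OF add b(2), of r]] by (cases "r = 0") auto
    qed
  qed
qed

lemma matrix_power_0 [simp]: "matrix_power A 0 = mat 1"
  by (simp add: matrix_power_def)

lemma matrix_power_Suc: "matrix_power A (Suc k) = matrix_power A k ** A"
  by (simp add: matrix_power_def)

lemma matrix_power_add: "matrix_power A (j + k) = matrix_power A j ** matrix_power A k"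
  by (induction k) (simp_all add: matrix_power_Suc matrix_mul_assoc)

lemma matrix_mult_nonneg:
  fixes A B :: "real ^ 's ^ 's"
  assumes "\<And>x y. 0 \<le> A $ x $ y" and "\<And>x y. 0 \<le> B $ x $ y"
  shows "0 \<le> (A ** B) $ x $ y"
  unfolding matrix_matrix_mult_def using assms by (auto intro!: sum_nonneg)

lemma matrix_power_nonneg:
  fixes A :: "real ^ 's ^ 's"
  assumes "\<And>x y. 0 \<le> A $ x $ y"
  shows "0 \<le> matrix_power A k $ x $ y"
proof (induction k arbitrary: x y)
  case 0
  then show ?case by (simp add: mat_def)
next
  case (Suc k)
  then show ?case using assms by (simp add: matrix_power_Suc matrix_mult_nonneg)
qed

lemma matrix_power_path:
  fixes A :: "real ^ 's ^ 's"
  assumes nonneg: "\<And>x y. 0 \<le> A $ x $ y"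
    and "0 < matrix_power A j $ x $ y" and "0 < matrix_power A k $ y $ z"
  shows "0 < matrix_power A (j + k) $ x $ z"
proof -
  have "0 < matrix_power A j $ x $ y * matrix_power A k $ y $ z"
    using assms by simp
  also have "\<dots> \<le> (\<Sum>u\<in>UNIV. matrix_power A j $ x $ u * matrix_power A k $ u $ z)"
    by (rule member_le_sum) (simp_all add: matrix_power_nonneg[OF nonneg])
  also have "\<dots> = matrix_power A (j + k) $ x $ z"
    by (simp add: matrix_power_add matrix_matrix_mult_def)
  finally show ?thesis .
qed

text \<open>The return times to \<open>x\<close> are closed under addition and have gcd 1, so all
  large times are return times. A long loop at \<open>x\<close> followed by a path of length
  \<open>K x y\<close> to \<open>y\<close> has the same total length \<open>N\<close> for all
  pairs.\<close>

lemma irreducible_aperiodic_primitive: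
  fixes A :: "real ^ 's ^ 's"
  assumes nonneg: "\<And>x y. 0 \<le> A $ x $ y"
    and "irreducible_matrix A" and "aperiodic_matrix A"
  shows "\<exists>N>0. \<forall>x y. 0 < matrix_power A N $ x $ y"
proof -
  have "\<exists>N. \<forall>m\<ge>N. m \<in> {k. k > 0 \<and> matrix_power A k $ x $ x > 0}" for x
    using assms(3) matrix_power_path[OF nonneg]
    by (intro add_closed_Gcd_1_eventually) (auto simp: aperiodic_matrix_def)
  then obtain R where R: "\<And>x m. R x \<le> m \<Longrightarrow> 0 < matrix_power A m $ x $ x"
    by (metis (mono_tags, lifting) mem_Collect_eq)
  obtain K where K: "\<And>x y. 0 < matrix_power A (K x y) $ x $ y"
    using assms(2) unfolding irreducible_matrix_def by metis
  \<comment> \<open>The sums stand in for maxima: \<open>N - K x y\<close> is at least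
    \<open>R x\<close> for every pair, and \<open>Suc\<close> makes \<open>N\<close>
    positive.\<close>
  define N where "N = Suc (\<Sum>x\<in>UNIV. R x + (\<Sum>y\<in>UNIV. K x y))"
  have "0 < matrix_power A N $ x $ y" for x y
  proof -
    have "K x y \<le> (\<Sum>y\<in>UNIV. K x y)" by (rule member_le_sum) auto
    moreover have "R x + (\<Sum>y\<in>UNIV. K x y) \<le> (\<Sum>x\<in>UNIV. R x + (\<Sum>y\<in>UNIV. K x y))"
      by (rule member_le_sum) auto
    ultimately have "R x + K x y \<le> N" by (simp add: N_def)
    then show ?thesis
      using matrix_power_path[OF nonneg R K, of x "N - K x y" y] by simp
  qed
  then show ?thesis by (auto simp: N_def)
qed

subsection \<open>Geometric ergodicity\<close>

lemma inner_one_vec: "(v :: real ^ 's) \<bullet> 1 = (\<Sum>x\<in>UNIV. v $ x)"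
  by (simp add: inner_vec_def)

lemma stochastic_matrix_iff:
  "stochastic_matrix P \<longleftrightarrow> (\<forall>x y. 0 \<le> P $ x $ y) \<and> P *v 1 = 1"
  by (auto simp: stochastic_matrix_def prob_vector_def vec_eq_iff matrix_vector_mult_def)

lemma stochastic_inner_one:
  "stochastic_matrix P \<Longrightarrow> (v v* P) \<bullet> 1 = v \<bullet> 1"
  by (simp add: dot_lmul_matrix stochastic_matrix_iff)

lemma prob_vector_iff: "prob_vector p \<longleftrightarrow> (\<forall>x. 0 \<le> p $ x) \<and> p \<bullet> 1 = 1"
  by (simp add: prob_vector_def inner_one_vec)

lemma prob_vector_mult:
  assumes "prob_vector p" and "stochastic_matrix P"
  shows "prob_vector (p v* P)"
  using assms stochastic_inner_one[of P p]
  by (auto simp: prob_vector_iff stochastic_matrix_iff vector_matrix_mult_def intro!: sum_nonneg)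

lemma stochastic_matrix_mult:
  assumes "stochastic_matrix P" and "stochastic_matrix Q"
  shows "stochastic_matrix (P ** Q)"
  using assms
  by (auto simp: stochastic_matrix_iff matrix_mult_nonneg matrix_vector_mul_assoc[symmetric])

lemma stochastic_matrix_prod:
  assumes "\<And>i. 1 \<le> i \<Longrightarrow> stochastic_matrix (P i)"
  shows "stochastic_matrix (matrix_prod P k)"
proof (induction k)
  case 0
  then show ?case by (simp add: stochastic_matrix_iff mat_def[of 1]) (simp add: mat_def[symmetric])
next
  case (Suc k)
  then show ?case using assms by (simp add: stochastic_matrix_mult)
qed

lemma stochastic_matrix_power:
  "stochastic_matrix P \<Longrightarrow> stochastic_matrix (matrix_power P k)"
  by (simp add: matrix_power_def stochastic_matrix_prod)

lemma prob_vector_norm_le_1: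
  assumes "prob_vector p"
  shows "norm p \<le> 1"
  using norm_le_l1_cart[of p] assms by (simp add: prob_vector_def)

text \<open>Doeblin's contraction is natural in this norm; passing to and from the Euclidean norm
  costs only the factor \<open>CARD('s)\<close>.\<close>

definition l1_norm :: "real ^ 's \<Rightarrow> real" where
  "l1_norm v = (\<Sum>x\<in>UNIV. \<bar>v $ x\<bar>)"

lemma norm_le_l1_norm: "norm v \<le> l1_norm v"
  unfolding l1_norm_def by (rule norm_le_l1_cart)

lemma l1_norm_le_norm: "l1_norm (v :: real ^ 's) \<le> CARD('s) * norm v"
  unfolding l1_norm_def by (rule sum_bounded_above) (simp add: component_le_norm_cart)

lemma l1_norm_nonneg: "0 \<le> l1_norm v"
  by (simp add: l1_norm_def sum_nonneg)

text \<open>Doeblin's argument: \<open>v\<close> annihilates the constant matrix \<open>\<delta>\<close>, which can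
  therefore be subtracted from \<open>Q\<close>.\<close>

lemma l1_norm_contraction:
  fixes Q :: "real ^ 's ^ 's" and \<delta> :: real
  assumes Q: "stochastic_matrix Q" and le: "\<And>x y. \<delta> \<le> Q $ x $ y" and v: "v \<bullet> 1 = 0"
  shows "l1_norm (v v* Q) \<le> (1 - CARD('s) * \<delta>) * l1_norm v"
proof -
  have row: "(\<Sum>y\<in>UNIV. Q $ x $ y) = 1" for x
    using Q by (simp add: stochastic_matrix_def prob_vector_def)
  have "\<bar>(v v* Q) $ y\<bar> \<le> (\<Sum>x\<in>UNIV. (Q $ x $ y - \<delta>) * \<bar>v $ x\<bar>)" for y
  proof -
    have "(\<Sum>x\<in>UNIV. (Q $ x $ y - \<delta>) * v $ x)
        = (\<Sum>x\<in>UNIV. Q $ x $ y * v $ x) - \<delta> * (v \<bullet> 1)"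
      by (simp add: left_diff_distrib sum_subtractf inner_one_vec sum_distrib_left)
    also have "(\<Sum>x\<in>UNIV. Q $ x $ y * v $ x) = (v v* Q) $ y"
      by (simp add: vector_matrix_mult_def mult.commute)
    finally have "(\<Sum>x\<in>UNIV. (Q $ x $ y - \<delta>) * v $ x) = (v v* Q) $ y"
      using v by simp
    then have "\<bar>(v v* Q) $ y\<bar> \<le> (\<Sum>x\<in>UNIV. \<bar>(Q $ x $ y - \<delta>) * v $ x\<bar>)"
      using sum_abs[of "\<lambda>x. (Q $ x $ y - \<delta>) * v $ x" UNIV] by (simp only:)
    then show ?thesis using le by (simp add: abs_mult)
  qed
  then have "l1_norm (v v* Q) \<le> (\<Sum>y\<in>UNIV. \<Sum>x\<in>UNIV. (Q $ x $ y - \<delta>) * \<bar>v $ x\<bar>)"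
    unfolding l1_norm_def by (rule sum_mono)
  also have "\<dots> = (\<Sum>x\<in>UNIV. (1 - CARD('s) * \<delta>) * \<bar>v $ x\<bar>)"
    by (subst sum.swap) (simp add: sum_distrib_right[symmetric] sum_subtractf row)
  finally show ?thesis by (simp add: l1_norm_def sum_distrib_left)
qed

text \<open>The \<open>N\<close>-th power contracts zero-sum vectors by \<kappa> and no power
  expands them in \<open>l1_norm\<close>. Writing \<open>k\<close> as a multiple of \<open>N\<close>
  plus a remainder gives decay at the rate of the \<open>N\<close>-th root of \<kappa>.\<close>

lemma primitive_zero_sum_decay:
  fixes P :: "real ^ 's ^ 's"
  assumes P: "stochastic_matrix P" and "0 < N" and pos: "\<And>x y. 0 < matrix_power P N $ x $ y"
  shows "\<exists>C \<rho>. 0 < C \<and> 0 < \<rho> \<and> \<rho> < 1 \<and>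
    (\<forall>v k. v \<bullet> 1 = 0 \<longrightarrow> norm (v v* matrix_power P k) \<le> C * \<rho> ^ k * norm v)"
proof -
  define \<delta> where "\<delta> = Min (range (\<lambda>(x, y). matrix_power P N $ x $ y))"
  have \<delta>: "0 < \<delta>" "\<And>x y. \<delta> \<le> matrix_power P N $ x $ y"
    unfolding \<delta>_def using pos by (auto intro!: Min_le)
  \<comment> \<open>The bound 1/2 keeps \<kappa> positive, as \<open>1 - CARD('s) * \<delta>\<close>
    vanishes when all entries are equal; later \<kappa> is a divisor.\<close>
  define \<kappa> where "\<kappa> = max (1 / 2) (1 - CARD('s) * \<delta>)"
  define \<rho> where "\<rho> = root N \<kappa>"
  have \<kappa>: "0 < \<kappa>" "\<kappa> < 1" using \<delta> by (auto simp: \<kappa>_def)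
  then have \<rho>: "0 < \<rho>" "\<rho> < 1" "\<rho> ^ N = \<kappa>"
    using \<open>0 < N\<close> by (auto simp: \<rho>_def)
  \<comment> \<open>Doeblin's estimate with lower bound 0 for the entries says that no power
    expands.\<close>
  have "l1_norm (v v* matrix_power P k) \<le> l1_norm v"
    if "v \<bullet> 1 = 0" for v k
    using l1_norm_contraction[OF stochastic_matrix_power[OF P], of 0 k v] that
      stochastic_matrix_power[OF P, of k] by (simp add: stochastic_matrix_iff)
  moreover have N: "l1_norm (v v* matrix_power P N) \<le> \<kappa> * l1_norm v"
    if "v \<bullet> 1 = 0" for v
    using l1_norm_contraction[OF stochastic_matrix_power[OF P] \<delta>(2) that]
      mult_right_mono[OF _ l1_norm_nonneg, of "1 - CARD('s) * \<delta>" \<kappa> v]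
    by (simp add: \<kappa>_def)
  moreover have "l1_norm (v v* matrix_power P (j * N)) \<le> \<kappa> ^ j * l1_norm v"
    if "v \<bullet> 1 = 0" for v j
    using that
  proof (induction j arbitrary: v)
    case 0
    then show ?case by simp
  next
    case (Suc j)
    have "l1_norm (v v* matrix_power P (Suc j * N)) =
        l1_norm ((v v* matrix_power P N) v* matrix_power P (j * N))"
      by (simp add: matrix_power_add vector_matrix_mul_assoc)
    also have "\<dots> \<le> \<kappa> ^ j * l1_norm (v v* matrix_power P N)"
      using Suc stochastic_inner_one[OF stochastic_matrix_power[OF P]] by simp
    also have "\<dots> \<le> \<kappa> ^ j * (\<kappa> * l1_norm v)"
      using \<kappa> N Suc.prems by (intro mult_left_mono) auto
    finally show ?case by (simp add: mult_ac)
  qed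
  ultimately have *: "l1_norm (v v* matrix_power P k) \<le> \<kappa> ^ (k div N) * l1_norm v"
    if "v \<bullet> 1 = 0" for v k
  proof -
    have "v v* matrix_power P k = (v v* matrix_power P (k div N * N)) v* matrix_power P (k mod N)"
      by (simp add: vector_matrix_mul_assoc matrix_power_add[symmetric])
    then show ?thesis
      using that \<open>\<And>v k. v \<bullet> 1 = 0 \<Longrightarrow> l1_norm (v v* matrix_power P k) \<le> l1_norm v\<close>
        [of "v v* matrix_power P (k div N * N)" "k mod N"]
        \<open>\<And>v j. v \<bullet> 1 = 0 \<Longrightarrow> l1_norm (v v* matrix_power P (j * N)) \<le> \<kappa> ^ j * l1_norm v\<close>
        [of v "k div N"]
        stochastic_inner_one[OF stochastic_matrix_power[OF P]]
      by simp
  qed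
  have "norm (v v* matrix_power P k) \<le> CARD('s) / \<kappa> * \<rho> ^ k * norm v"
    if "v \<bullet> 1 = 0" for v k
  proof -
    \<comment> \<open>Rounding \<open>k\<close> down to a multiple of \<open>N\<close> costs at most
      one factor \<kappa>, which is paid for by the constant.\<close>
    have "\<kappa> * \<kappa> ^ (k div N) = \<rho> ^ (N + k div N * N)"
      using \<rho>(3) by (simp add: power_add power_mult mult.commute)
    also have "\<dots> \<le> \<rho> ^ k"
    proof (rule power_decreasing)
      show "k \<le> N + k div N * N"
        using \<open>0 < N\<close> by (metis add.commute add_le_cancel_left div_mult_mod_eq mod_less_divisor
            nat_less_le)
    qed (use \<rho> in auto)
    finally have kr: "\<kappa> ^ (k div N) \<le> \<rho> ^ k / \<kappa>"
      using \<kappa> by (simp add: field_simps)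
    have "norm (v v* matrix_power P k) \<le> \<kappa> ^ (k div N) * l1_norm v"
      using * that norm_le_l1_norm order_trans by blast
    also have "\<dots> \<le> (\<rho> ^ k / \<kappa>) * (CARD('s) * norm v)"
      using \<kappa> \<rho> by (intro mult_mono kr l1_norm_le_norm l1_norm_nonneg) auto
    finally show ?thesis by (simp add: mult_ac)
  qed
  then show ?thesis
    using \<rho> \<kappa> by (intro exI[of _ "CARD('s) / \<kappa>"] exI[of _ \<rho>]) auto
qed

lemma closed_prob_vectors: "closed {p :: real ^ 's. prob_vector p}"
  unfolding prob_vector_def
  by (intro closed_Collect_conj closed_Collect_all closed_Collect_le closed_Collect_eq continuous_intros)

lemma ex_prob_vector: "\<exists>p :: real ^ 's. prob_vector p"
  by (rule exI[of _ "\<chi> x. 1 / CARD('s)"]) (simp add: prob_vector_def)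

text \<open>Differences of probability vectors have zero sum, so a high power of \<open>P\<close> is
  a contraction on the complete set of probability vectors and has one fixed point there. As
  \<open>P\<close> commutes with its power, it maps this point to another fixed point, hence to
  itself. This makes the description \<open>THE\<close> in \<open>stationary_distribution\<close>
  meaningful.\<close>

lemma decay_imp_ex1_stationary:
  fixes P :: "real ^ 's ^ 's"
  assumes P: "stochastic_matrix P" and \<rho>: "0 < C" "0 < \<rho>" "\<rho> < 1"
    and decay: "\<And>v k. v \<bullet> 1 = 0 \<Longrightarrow> norm (v v* matrix_power P k) \<le> C * \<rho> ^ k * norm v"
  shows "\<exists>!p. prob_vector p \<and> p v* P = p"
proof -
  obtain M where M: "\<rho> ^ M < 1 / (2 * C)"
    using real_arch_pow_inv[of "1 / (2 * C)" \<rho>] \<rho> by auto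
  let ?Q = "matrix_power P M"
  have "\<exists>!p. p \<in> {p. prob_vector p} \<and> p v* ?Q = p"
  proof (rule Banach_fix[of _ "1 / 2"])
    show "complete {p :: real ^ 's. prob_vector p}"
      using closed_prob_vectors complete_eq_closed by blast
    show "{p :: real ^ 's. prob_vector p} \<noteq> {}"
      using ex_prob_vector by auto
    show "(\<lambda>p. p v* ?Q) ` {p. prob_vector p} \<subseteq> {p. prob_vector p}"
      using prob_vector_mult stochastic_matrix_power[OF P] by auto
    show "dist (p v* ?Q) (q v* ?Q) \<le> 1 / 2 * dist p q"
      if "p \<in> {p. prob_vector p}" "q \<in> {p. prob_vector p}" for p q
    proof -
      have "norm ((p - q) v* ?Q) \<le> C * \<rho> ^ M * norm (p - q)"
        using that by (intro decay) (auto simp: prob_vector_iff inner_diff_left)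
      also have "\<dots> \<le> 1 / 2 * norm (p - q)"
        using M \<rho> by (intro mult_right_mono) (auto simp: field_simps)
      finally show ?thesis by (simp add: dist_norm algebra_simps)
    qed
  qed auto
  then obtain p where p: "prob_vector p" "p v* ?Q = p"
    and uniq: "\<And>q. prob_vector q \<Longrightarrow> q v* ?Q = q \<Longrightarrow> q = p"
    unfolding mem_Collect_eq by metis
  have comm: "P ** ?Q = ?Q ** P"
    using matrix_power_add[of P 1 M] matrix_power_Suc[of P M] matrix_power_Suc[of P 0] by simp
  have "(p v* P) v* ?Q = p v* P"
    by (metis comm p(2) vector_matrix_mul_assoc)
  then have "p v* P = p"
    using uniq prob_vector_mult[OF p(1) P] by blast
  moreover have "q = p" if "prob_vector q" "q v* P = q" for q
  proof -
    have "q v* matrix_power P k = q" for k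
      by (induction k) (simp_all add: matrix_power_Suc that vector_matrix_mul_assoc[symmetric])
    then show ?thesis using uniq that by blast
  qed
  ultimately show ?thesis using p by blast
qed

lemma vector_mult_matrix_with_rows: "v v* matrix_with_rows p = (v \<bullet> 1) *\<^sub>R p"
  by (simp add: vec_eq_iff vector_matrix_mult_def matrix_with_rows_def inner_one_vec
      sum_distrib_left mult.commute)

text \<open>A left null vector of \<open>I - P + \<Pi>\<close> has zero sum, hence is fixed by \<open>P\<close> and
  vanishes by the decay.\<close>

lemma fundamental_matrix_invertible:
  fixes P :: "real ^ 's ^ 's"
  assumes P: "stochastic_matrix P" and \<rho>: "0 < \<rho>" "\<rho> < 1"
    and decay: "\<And>v k. v \<bullet> 1 = 0 \<Longrightarrow> norm (v v* matrix_power P k) \<le> C * \<rho> ^ k * norm v"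
    and p: "prob_vector p"
  shows "invertible (mat 1 - P + matrix_with_rows p)"
proof -
  let ?F = "mat 1 - P + matrix_with_rows p"
  have "v = 0" if "v v* ?F = 0" for v
  proof -
    have *: "v - v v* P + (v \<bullet> 1) *\<^sub>R p = 0"
      using that by (simp add: algebra_simps vector_mult_matrix_with_rows)
    \<comment> \<open>\<open>P\<close> preserves coordinate sums, so pairing with 1 cancels the
      first two terms and leaves \<open>v \<bullet> 1\<close>.\<close>
    then have "(v - v v* P + (v \<bullet> 1) *\<^sub>R p) \<bullet> 1 = 0"
      by (simp only: inner_zero_left)
    then have v: "v \<bullet> 1 = 0"
      using p by (simp add: inner_add_left inner_diff_left stochastic_inner_one[OF P] prob_vector_iff)
    then have "v v* P = v" using * by simp
    then have "v v* matrix_power P k = v" for k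
      by (induction k) (simp_all add: matrix_power_Suc vector_matrix_mul_assoc[symmetric])
    then have "norm v \<le> C * \<rho> ^ k * norm v" for k
      using decay[OF v, of k] by simp
    moreover have "(\<lambda>k. C * \<rho> ^ k * norm v) \<longlonglongrightarrow> C * 0 * norm v"
      using \<rho> by (intro tendsto_intros LIMSEQ_realpow_zero) auto
    ultimately have "norm v \<le> C * 0 * norm v"
      by (intro LIMSEQ_le_const) auto
    then show ?thesis by simp
  qed
  \<comment> \<open>A trivial left kernel of \<open>?F\<close> is a trivial kernel of its transpose;
    a left inverse of the transpose yields a right inverse of \<open>?F\<close>, which suffices for
    a square matrix.\<close>
  then have "\<exists>B. B ** transpose ?F = mat 1"
    by (simp add: matrix_left_invertible_ker)
  then show ?thesis
    by (simp add: left_invertible_transpose invertible_right_inverse)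
qed

subsection \<open>Norm estimates\<close>

lemma norm_vector_matrix_mult:
  fixes A :: "real ^ 't ^ 's"
  shows "norm (v v* A) \<le> norm v * norm A"
proof -
  have "v v* A = (\<Sum>i\<in>UNIV. v $ i *\<^sub>R A $ i)"
    by (simp add: vec_eq_iff vector_matrix_mult_def mult.commute)
  then have "norm (v v* A) \<le> (\<Sum>i\<in>UNIV. norm (v $ i *\<^sub>R A $ i))"
    by (simp only: norm_sum)
  also have "\<dots> \<le> (\<Sum>i\<in>UNIV. \<bar>norm (v $ i)\<bar> * \<bar>norm (A $ i)\<bar>)"
    by simp
  also have "\<dots> \<le> norm v * norm A"
    unfolding norm_vec_def[of v] norm_vec_def[of A] by (rule L2_set_mult_ineq)
  finally show ?thesis .
qed

lemma norm_matrix_vector_mult: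
  fixes A :: "real ^ 't ^ 's"
  shows "norm (A *v x) \<le> norm A * norm x"
proof -
  have "norm (A *v x) \<le> L2_set (\<lambda>i. norm (A $ i) * norm x) UNIV"
    unfolding norm_vec_def[of "A *v x"]
    by (rule L2_set_mono) (simp_all add: matrix_vector_mul_component Cauchy_Schwarz_ineq2)
  also have "\<dots> = norm A * norm x"
    by (simp add: norm_vec_def[of A] L2_set_left_distrib)
  finally show ?thesis .
qed

text \<open>Carries the hypothesis, stated in the row sum norm, over to the Euclidean norm used in
  all estimates; the dimension factor disappears in the O-constant.\<close>

lemma norm_le_row_sum_norm:
  "norm (A :: real ^ 's ^ 's) \<le> CARD('s) * row_sum_norm A"
proof -
  have "norm A \<le> (\<Sum>x\<in>UNIV. norm (A $ x))"
    unfolding norm_vec_def[of A] by (rule L2_set_le_sum) simp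
  also have "\<dots> \<le> (\<Sum>x\<in>UNIV. \<Sum>y\<in>UNIV. \<bar>A $ x $ y\<bar>)"
    by (intro sum_mono norm_le_l1_cart)
  also have "\<dots> \<le> CARD('s) * row_sum_norm A"
    unfolding row_sum_norm_def by (rule sum_bounded_above) (auto intro!: Max_ge)
  finally show ?thesis .
qed

lemma sum_geometric_le:
  assumes "0 < \<rho>" and "\<rho> < (1 :: real)"
  shows "(\<Sum>j<n. \<rho> ^ (n - 1 - j)) \<le> 1 / (1 - \<rho>)"
proof -
  have "(\<Sum>j<n. \<rho> ^ (n - 1 - j)) = (\<Sum>j<n. \<rho> ^ j)"
    using sum.nat_diff_reindex[of "\<lambda>j. \<rho> ^ j" n] by simp
  also have "\<dots> = (1 - \<rho> ^ n) / (1 - \<rho>)"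
    using assms by (simp add: sum_gp_strict)
  also have "\<dots> \<le> 1 / (1 - \<rho>)"
    using assms by (intro divide_right_mono) auto
  finally show ?thesis .
qed

subsection \<open>Perturbed recursions\<close>

text \<open>Discrete variation of constants: the forcing \<open>y j\<close> enters at time
  \<open>j + 1\<close> and is then carried through the remaining \<open>n - 1 - j\<close>
  steps.\<close>

lemma perturbed_recursion:
  fixes x y :: "nat \<Rightarrow> real ^ 's"
  assumes rec: "\<And>m. m < n \<Longrightarrow> x (Suc m) = x m v* P + y m"
  shows "x n = x 0 v* matrix_power P n + (\<Sum>j<n. y j v* matrix_power P (n - 1 - j))"
  using rec
proof (induction n)
  case 0
  then show ?case by simp
next
  case (Suc n)
  have *: "(\<Sum>j<n. y j v* matrix_power P (n - 1 - j)) v* P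
      = (\<Sum>j<n. y j v* matrix_power P (n - j))"
  proof -
    have "linear (\<lambda>v :: real ^ 's. v v* P)"
      by (intro linearI) (simp_all add: algebra_simps scaleR_vector_matrix_assoc)
    then have "(\<Sum>j<n. y j v* matrix_power P (n - 1 - j)) v* P
      = (\<Sum>j<n. (y j v* matrix_power P (n - 1 - j)) v* P)"
      by (rule linear_sum)
    also have "\<dots> = (\<Sum>j<n. y j v* matrix_power P (n - j))"
    proof (rule sum.cong)
      fix j assume "j \<in> {..<n}"
      then have "n - j = Suc (n - 1 - j)" by auto
      then show "(y j v* matrix_power P (n - 1 - j)) v* P = y j v* matrix_power P (n - j)"
        by (simp only: matrix_power_Suc vector_matrix_mul_assoc)
    qed simp
    finally show ?thesis .
  qed
  have "x (Suc n) = x n v* P + y n"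
    using Suc.prems by simp
  also have "x n = x 0 v* matrix_power P n + (\<Sum>j<n. y j v* matrix_power P (n - 1 - j))"
    using Suc by simp
  finally show ?case
    by (simp add: vector_matrix_left_distrib *[simplified] matrix_power_Suc vector_matrix_mul_assoc)
qed

text \<open>Zero sums let the decay act on the initial value and on each forcing term separately. It
  serves twice: for the crude distance to \<pi> and for the final residual.\<close>

lemma perturbed_recursion_bound:
  fixes x y :: "nat \<Rightarrow> real ^ 's"
  assumes decay: "\<And>v k. v \<bullet> 1 = 0 \<Longrightarrow> norm (v v* matrix_power P k) \<le> C * \<rho> ^ k * norm v"
    and rec: "\<And>m. m < n \<Longrightarrow> x (Suc m) = x m v* P + y m"
    and x: "x 0 \<bullet> 1 = 0" and y: "\<And>m. m < n \<Longrightarrow> y m \<bullet> 1 = 0"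
  shows "norm (x n) \<le> C * \<rho> ^ n * norm (x 0) + C * (\<Sum>j<n. \<rho> ^ (n - 1 - j) * norm (y j))"
proof -
  have "x n = x 0 v* matrix_power P n + (\<Sum>j<n. y j v* matrix_power P (n - 1 - j))"
    by (rule perturbed_recursion) (rule rec)
  then have "norm (x n) \<le> norm (x 0 v* matrix_power P n)
      + norm (\<Sum>j<n. y j v* matrix_power P (n - 1 - j))"
    by (simp only: norm_triangle_ineq)
  also have "norm (\<Sum>j<n. y j v* matrix_power P (n - 1 - j))
      \<le> (\<Sum>j<n. C * \<rho> ^ (n - 1 - j) * norm (y j))"
    by (intro order_trans[OF norm_sum] sum_mono decay y) simp
  finally show ?thesis
    using decay[OF x, of n] by (simp add: sum_distrib_left mult.assoc)
qed

text \<open>For \<open>u = w v* Z\<close> one has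
  \<open>u - u v* P + (u \<bullet> 1) *\<^sub>R p = w\<close>. Pairing with 1 gives
  \<open>u \<bullet> 1 = 0\<close>, which removes the rank one term. The solution again has zero
  sum, so the equation can be solved a second time, which produces the square of
  \<open>Z\<close>.\<close>

lemma poisson_equation:
  fixes P Z :: "real ^ 's ^ 's"
  assumes P: "stochastic_matrix P" and p: "prob_vector p"
    and Z: "Z ** (mat 1 - P + matrix_with_rows p) = mat 1" and w: "w \<bullet> 1 = 0"
  shows "(w v* Z) \<bullet> 1 = 0" and "w v* Z - (w v* Z) v* P = w"
proof -
  define u where "u = w v* Z"
  have "u v* (mat 1 - P + matrix_with_rows p) = w"
    by (simp add: u_def vector_matrix_mul_assoc Z)
  then have *: "u - u v* P + (u \<bullet> 1) *\<^sub>R p = w"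
    by (simp add: vector_matrix_mult_add_rdistrib vector_matrix_mult_diff_rdistrib
        vector_mult_matrix_with_rows)
  then have "(u - u v* P + (u \<bullet> 1) *\<^sub>R p) \<bullet> 1 = 0"
    using w by simp
  then have "u \<bullet> 1 = 0"
    using p by (simp add: inner_add_left inner_diff_left stochastic_inner_one[OF P] prob_vector_iff)
  with * show "(w v* Z) \<bullet> 1 = 0" and "w v* Z - (w v* Z) v* P = w"
    by (simp_all add: u_def)
qed

subsection \<open>The expansion for fixed \<open>\<epsilon>\<close>\<close>

text \<open>The drift \<open>T\<^sub>m = m u - t + t P\<^sup>m\<close> is the solution of \<open>T\<^sub>0 = 0\<close>,
  \<open>T\<^sub>m\<^sub>+\<^sub>1 = T\<^sub>m P + m w\<close>, where \<open>u\<close> and \<open>t\<close> solve the Poisson equations for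
  \<open>w = \<pi> P1\<close> and \<open>u\<close>. Hence the residual
  \<open>\<mu> P\<^sub>1 \<dots> P\<^sub>m - \<pi> - \<epsilon> T\<^sub>m\<close> obeys a recursion with a forcing term of second order.\<close>

lemma expansion_residual_bound:
  fixes P0 P1 Z :: "real ^ 's ^ 's" and \<pi> \<mu> :: "real ^ 's" and Q :: "nat \<Rightarrow> real ^ 's ^ 's"
  defines "w \<equiv> \<pi> v* P1"
  defines "u \<equiv> w v* Z"
  defines "t \<equiv> u v* Z"
  assumes P0: "stochastic_matrix P0" and P1: "P1 *v 1 = 0"
    and \<pi>: "prob_vector \<pi>" "\<pi> v* P0 = \<pi>" and \<mu>: "prob_vector \<mu>"
    and Z: "Z ** (mat 1 - P0 + matrix_with_rows \<pi>) = mat 1"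
    and \<rho>: "0 < C" "0 < \<rho>" "\<rho> < 1"
    and decay: "\<And>v k. v \<bullet> 1 = 0 \<Longrightarrow> norm (v v* matrix_power P0 k) \<le> C * \<rho> ^ k * norm v"
    and Q: "\<And>i. 1 \<le> i \<Longrightarrow> stochastic_matrix (Q i)"
    and "0 \<le> \<epsilon>" and "0 < n"
    and Q_approx: "\<And>i. 1 \<le> i \<Longrightarrow> i \<le> n \<Longrightarrow>
      norm (Q i - (P0 + (\<epsilon> * (real i - 1)) *\<^sub>R P1)) \<le> \<eta>"
  shows "norm (\<mu> v* matrix_prod Q n - \<pi>
        - \<epsilon> *\<^sub>R (real n *\<^sub>R u - t + t v* matrix_power P0 n))
      \<le> 2 * C * \<rho> ^ n + C * (2 * C * (\<epsilon> * real n ^ 2 * norm P1) * \<rho> ^ n / \<rho>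
        + (C * (\<epsilon> * real n * norm P1 + \<eta>) / (1 - \<rho>) * (\<epsilon> * real n * norm P1) + \<eta>) / (1 - \<rho>))"
proof -
  define S where "S = 1 / (1 - \<rho>)"
  define a where "a = \<epsilon> * real n * norm P1"
  define \<delta> where "\<delta> = a + \<eta>"
  have "0 \<le> a" using \<open>0 \<le> \<epsilon>\<close> by (simp add: a_def)
  define \<nu> where "\<nu> m = \<mu> v* matrix_prod Q m" for m
  \<comment> \<open>Passing from step \<open>m\<close> to \<open>Suc m\<close> uses the matrix of
    index \<open>i = m + 1\<close>, whose factor \<open>i - 1\<close> is \<open>m\<close>.\<close>
  define E where "E m = Q (Suc m) - (P0 + (\<epsilon> * real m) *\<^sub>R P1)" for m
  have E: "norm (E m) \<le> \<eta>" if "m < n" for m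
    using Q_approx[of "Suc m"] that by (simp add: E_def)
  have \<nu>: "prob_vector (\<nu> m)" for m
    unfolding \<nu>_def by (intro prob_vector_mult stochastic_matrix_prod \<mu> Q)
  have \<nu>_Suc: "\<nu> (Suc m) = \<nu> m v* P0 + (\<epsilon> * real m) *\<^sub>R (\<nu> m v* P1) + \<nu> m v* E m" for m
  proof -
    have "Q (Suc m) = P0 + (\<epsilon> * real m) *\<^sub>R P1 + E m"
      by (simp add: E_def)
    then show ?thesis
      by (simp add: \<nu>_def vector_matrix_mul_assoc[symmetric] vector_matrix_mult_add_rdistrib
          vector_scaleR_matrix_ac)
  qed
  have P1_sum: "(v v* P1) \<bullet> 1 = 0" for v
    by (simp add: dot_lmul_matrix P1)
  \<comment> \<open>\<open>Q (Suc m)\<close> and \<open>P0\<close> both fix the constant vector and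
    \<open>P1\<close> annihilates it.\<close>
  have E_sum: "(v v* E m) \<bullet> 1 = 0" for v m
    using P0 Q[of "Suc m"] P1
    by (simp add: dot_lmul_matrix E_def stochastic_matrix_iff matrix_vector_mult_diff_rdistrib
        matrix_vector_mult_add_rdistrib scaleR_matrix_vector_assoc[symmetric])
  have u: "u \<bullet> 1 = 0" "u - u v* P0 = w" and t: "t \<bullet> 1 = 0" "t - t v* P0 = u"
    using poisson_equation[OF P0 \<pi>(1) Z] P1_sum unfolding u_def t_def w_def by blast+
  have \<nu>E: "norm (\<nu> m v* E m) \<le> \<eta>" if "m < n" for m
    using norm_vector_matrix_mult[of "\<nu> m" "E m"]
      mult_mono[OF prob_vector_norm_le_1[OF \<nu>, of m] E[OF that]] by simp
  have drift: "norm ((\<epsilon> * real m) *\<^sub>R (v v* P1)) \<le> norm v * a" if "m < n" for v m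
  proof -
    have "norm ((\<epsilon> * real m) *\<^sub>R (v v* P1)) \<le> (\<epsilon> * real m) * (norm v * norm P1)"
      using \<open>0 \<le> \<epsilon>\<close> by (simp add: norm_vector_matrix_mult mult_left_mono)
    also have "\<dots> \<le> (\<epsilon> * real n) * (norm v * norm P1)"
      using \<open>0 \<le> \<epsilon>\<close> that by (intro mult_right_mono mult_left_mono) auto
    finally show ?thesis by (simp add: a_def mult_ac)
  qed
  have start: "norm (\<nu> 0 - \<pi>) \<le> 2"
    using norm_triangle_ineq4[of "\<nu> 0" \<pi>] prob_vector_norm_le_1[OF \<nu>, of 0]
      prob_vector_norm_le_1[OF \<pi>(1)] by simp
  have "0 \<le> \<eta>"
    using order_trans[OF norm_ge_zero E] \<open>0 < n\<close> by blast
  then have "0 \<le> \<delta>"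
    using \<open>0 \<le> a\<close> by (simp add: \<delta>_def)
  \<comment> \<open>Crude first pass: drift and model error together are treated as forcing of size
    at most \<delta>, summed geometrically.\<close>
  have first: "norm (\<nu> m - \<pi>) \<le> 2 * C * \<rho> ^ m + C * \<delta> * S" if m: "m < n" for m
  proof -
    have "norm (\<nu> m - \<pi>) \<le> C * \<rho> ^ m * norm (\<nu> 0 - \<pi>) + C * (\<Sum>j<m. \<rho> ^ (m - 1 - j)
        * norm ((\<epsilon> * real j) *\<^sub>R (\<nu> j v* P1) + \<nu> j v* E j))"
    proof (rule perturbed_recursion_bound[where x = "\<lambda>m. \<nu> m - \<pi>" and P = P0, OF decay])
      show "\<nu> (Suc j) - \<pi> = (\<nu> j - \<pi>) v* P0 + ((\<epsilon> * real j) *\<^sub>R (\<nu> j v* P1) + \<nu> j v* E j)" for j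
        by (simp add: \<nu>_Suc vector_matrix_mult_diff_distrib \<pi>)
      show "(\<nu> 0 - \<pi>) \<bullet> 1 = 0"
        using \<nu> \<pi> by (simp add: inner_diff_left prob_vector_iff)
      show "((\<epsilon> * real j) *\<^sub>R (\<nu> j v* P1) + \<nu> j v* E j) \<bullet> 1 = 0" for j
        by (simp add: inner_add_left P1_sum E_sum)
    qed
    also have "\<dots> \<le> C * \<rho> ^ m * 2 + C * (\<Sum>j<m. \<rho> ^ (m - 1 - j) * \<delta>)"
    proof (intro add_mono mult_left_mono sum_mono)
      show "norm (\<nu> 0 - \<pi>) \<le> 2"
        by (rule start)
      show "norm ((\<epsilon> * real j) *\<^sub>R (\<nu> j v* P1) + \<nu> j v* E j) \<le> \<delta>" if "j \<in> {..<m}" for j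
      proof -
        have "j < n" using that m by simp
        then have "norm ((\<epsilon> * real j) *\<^sub>R (\<nu> j v* P1)) \<le> 1 * a"
          using drift prob_vector_norm_le_1[OF \<nu>] \<open>0 \<le> a\<close> mult_right_mono order_trans by metis
        then show ?thesis
          using norm_triangle_le[OF add_mono[OF _ \<nu>E[OF \<open>j < n\<close>]]] by (simp add: \<delta>_def)
      qed
    qed (use \<rho> in auto)
    also have "\<dots> \<le> C * \<rho> ^ m * 2 + C * (S * \<delta>)"
      unfolding S_def sum_distrib_right[symmetric]
      using sum_geometric_le[OF \<rho>(2,3), of m] \<rho> \<open>0 \<le> \<delta>\<close>
      by (intro add_left_mono mult_left_mono mult_right_mono) auto
    finally show ?thesis by (simp add: mult_ac)
  qed
  define T where "T m = real m *\<^sub>R u - t + t v* matrix_power P0 m" for m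
  \<comment> \<open>The forcing that remains once \<pi> replaces \<open>\<nu> m\<close> in the
    drift; by \<open>first\<close> its \<open>P1\<close> part is small apart from a
    transient.\<close>
  define R where "R m = (\<epsilon> * real m) *\<^sub>R ((\<nu> m - \<pi>) v* P1) + \<nu> m v* E m" for m
  \<comment> \<open>The Poisson equations turn \<open>u v* P0\<close> into \<open>u - w\<close> and
    \<open>t v* P0\<close> into \<open>t - u\<close>: the new \<open>m *\<^sub>R w\<close> cancels,
    and \<open>t - u\<close> supplies the additional \<open>u\<close>.\<close>
  have T_Suc: "T (Suc m) = T m v* P0 + real m *\<^sub>R w" for m
  proof -
    have "T m v* P0 = real m *\<^sub>R (u v* P0) - t v* P0 + t v* matrix_power P0 (Suc m)"
      by (simp add: T_def vector_matrix_left_distrib vector_matrix_mult_diff_distrib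
          scaleR_vector_matrix_assoc matrix_power_Suc vector_matrix_mul_assoc)
    also have "u v* P0 = u - w" using u(2) by (simp add: algebra_simps)
    also have "t v* P0 = t - u" using t(2) by (simp add: algebra_simps)
    finally show ?thesis by (simp add: T_def algebra_simps)
  qed
  have "(\<Sum>j<n. \<rho> ^ (n - 1 - j) * norm (R j))
      \<le> (\<Sum>j<n. 2 * C * a * (\<rho> ^ n / \<rho>) + \<rho> ^ (n - 1 - j) * (C * \<delta> * S * a + \<eta>))"
  proof (rule sum_mono)
    fix j assume "j \<in> {..<n}"
    then have j: "j < n" by simp
    have "norm (R j) \<le> norm (\<nu> j - \<pi>) * a + \<eta>"
      unfolding R_def by (intro norm_triangle_le add_mono drift[OF j] \<nu>E[OF j])
    also have "\<dots> \<le> (2 * C * \<rho> ^ j + C * \<delta> * S) * a + \<eta>"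
      using mult_right_mono[OF first[OF j] \<open>0 \<le> a\<close>] by simp
    finally have "\<rho> ^ (n - 1 - j) * norm (R j)
        \<le> \<rho> ^ (n - 1 - j) * ((2 * C * \<rho> ^ j + C * \<delta> * S) * a + \<eta>)"
      using \<rho> by (intro mult_left_mono) auto
    also have "\<dots> = 2 * C * a * (\<rho> ^ (n - 1 - j) * \<rho> ^ j)
        + \<rho> ^ (n - 1 - j) * (C * \<delta> * S * a + \<eta>)"
      by (simp add: algebra_simps)
    \<comment> \<open>The transient of the first pass and the later damping multiply to a power
      independent of \<open>j\<close>, so the sum yields a factor \<open>n\<close> but keeps
      \<open>\<rho> ^ n\<close>.\<close>
    also have "\<rho> ^ (n - 1 - j) * \<rho> ^ j = \<rho> ^ n / \<rho>"
      using j \<rho> by (simp add: power_add[symmetric] power_diff[symmetric] flip: power_Suc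
          , simp add: field_simps flip: power_Suc)
    finally show "\<rho> ^ (n - 1 - j) * norm (R j)
        \<le> 2 * C * a * (\<rho> ^ n / \<rho>) + \<rho> ^ (n - 1 - j) * (C * \<delta> * S * a + \<eta>)" .
  qed
  also have "\<dots> \<le> real n * (2 * C * a * (\<rho> ^ n / \<rho>)) + S * (C * \<delta> * S * a + \<eta>)"
  proof -
    have "0 \<le> C * \<delta> * S * a + \<eta>"
      using \<open>0 \<le> a\<close> \<open>0 \<le> \<eta>\<close> \<open>0 \<le> \<delta>\<close> \<rho> by (simp add: S_def)
    from mult_right_mono[OF sum_geometric_le[OF \<rho>(2,3), of n] this] show ?thesis
      by (simp add: sum.distrib sum_distrib_right S_def)
  qed
  finally have forcing: "(\<Sum>j<n. \<rho> ^ (n - 1 - j) * norm (R j))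
      \<le> real n * (2 * C * a * (\<rho> ^ n / \<rho>)) + S * (C * \<delta> * S * a + \<eta>)" .
  have "norm (\<nu> n - \<pi> - \<epsilon> *\<^sub>R T n)
      \<le> C * \<rho> ^ n * norm (\<nu> 0 - \<pi> - \<epsilon> *\<^sub>R T 0) + C * (\<Sum>j<n. \<rho> ^ (n - 1 - j) * norm (R j))"
  proof (rule perturbed_recursion_bound[where x = "\<lambda>m. \<nu> m - \<pi> - \<epsilon> *\<^sub>R T m" and P = P0, OF decay])
    show "\<nu> (Suc m) - \<pi> - \<epsilon> *\<^sub>R T (Suc m) = (\<nu> m - \<pi> - \<epsilon> *\<^sub>R T m) v* P0 + R m" for m
      by (simp add: \<nu>_Suc T_Suc R_def vector_matrix_mult_diff_distrib scaleR_vector_matrix_assoc \<pi>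
          w_def scaleR_right_distrib scaleR_right_diff_distrib)
    show "(\<nu> 0 - \<pi> - \<epsilon> *\<^sub>R T 0) \<bullet> 1 = 0"
      using \<nu> \<pi> by (simp add: T_def inner_diff_left prob_vector_iff)
    show "R m \<bullet> 1 = 0" for m
      by (simp add: R_def inner_add_left P1_sum E_sum)
  qed
  \<comment> \<open>As \<open>T 0 = 0\<close>, the initial residual is
    \<open>\<nu> 0 - \<pi>\<close>, of norm at most 2.\<close>
  also have "\<dots> \<le> C * \<rho> ^ n * 2 + C * (real n * (2 * C * a * (\<rho> ^ n / \<rho>)) + S * (C * \<delta> * S * a + \<eta>))"
    using \<rho> forcing start by (intro add_mono mult_left_mono) (auto simp: T_def)
  finally show ?thesis
    by (simp add: \<nu>_def T_def S_def \<delta>_def a_def power2_eq_square mult_ac)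
qed

text \<open>Under the size conditions every term of the residual bound is a constant times
  \<open>\<epsilon> ^ 2 * real n ^ 3\<close>. The constant \<open>B\<close> is chosen before
  \<epsilon>, \<open>n\<close> and \<open>Q\<close>, which is the uniformity needed for the
  limit.\<close>

lemma expansion_bound:
  fixes P0 P1 Z :: "real ^ 's ^ 's" and \<pi> \<mu> r :: "real ^ 's"
  assumes P0: "stochastic_matrix P0" and P1: "P1 *v 1 = 0"
    and \<pi>: "prob_vector \<pi>" "\<pi> v* P0 = \<pi>" and \<mu>: "prob_vector \<mu>"
    and Z: "Z ** (mat 1 - P0 + matrix_with_rows \<pi>) = mat 1"
    and \<rho>: "0 < C" "0 < \<rho>" "\<rho> < 1"
    and decay: "\<And>v k. v \<bullet> 1 = 0 \<Longrightarrow> norm (v v* matrix_power P0 k) \<le> C * \<rho> ^ k * norm v"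
    and "0 \<le> K"
  shows "\<exists>B. \<forall>\<epsilon> n Q. 0 < \<epsilon> \<longrightarrow> \<epsilon> \<le> 1 \<longrightarrow> 0 < n \<longrightarrow> \<epsilon> * real n ^ 2 \<le> 1 \<longrightarrow> \<rho> ^ n \<le> \<epsilon> ^ 2 \<longrightarrow>
    (\<forall>i\<ge>1. stochastic_matrix (Q i)) \<longrightarrow>
    (\<forall>i\<in>{1..n}. norm (Q i - (P0 + (\<epsilon> * (real i - 1)) *\<^sub>R P1)) \<le> K * (\<epsilon> ^ 2 * real n ^ 2)) \<longrightarrow>
    \<bar>(\<mu> v* matrix_prod Q n) \<bullet> r - (\<pi> \<bullet> r + \<epsilon> * real n * ((\<pi> v* P1 v* Z) \<bullet> r)
      - \<epsilon> * ((\<pi> v* P1 v* matrix_power Z 2) \<bullet> r))\<bar> \<le> B * (\<epsilon> ^ 2 * real n ^ 3)"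
proof (intro exI allI impI)
  define u where "u = \<pi> v* P1 v* Z"
  define t where "t = u v* Z"
  define a where "a = norm P1"
  have "0 \<le> a" by (simp add: a_def)
  define B1 where "B1 = 2 * C + C * (2 * C * a / \<rho>
    + (C * (a + K) / (1 - \<rho>) * a + K) / (1 - \<rho>))"
  fix \<epsilon> n Q
  assume \<epsilon>: "0 < \<epsilon>" "\<epsilon> \<le> 1" and n: "0 < n" and \<epsilon>n2: "\<epsilon> * real n ^ 2 \<le> 1" and \<rho>n: "\<rho> ^ n \<le> \<epsilon> ^ 2"
    and Q: "\<forall>i\<ge>1. stochastic_matrix (Q i)"
    and Q_approx: "\<forall>i\<in>{1..n}. norm (Q i - (P0 + (\<epsilon> * (real i - 1)) *\<^sub>R P1)) \<le> K * (\<epsilon> ^ 2 * real n ^ 2)"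
  define X where "X = \<epsilon> ^ 2 * real n ^ 3"
  have "real n \<le> real n ^ 2" "real n ^ 2 \<le> real n ^ 3" "1 \<le> real n ^ 3"
    using n power_increasing[of 1 2 "real n"] by (auto intro: power_increasing simp: Suc_leI)
  then have "\<epsilon> * real n \<le> \<epsilon> * real n ^ 2" and X: "\<epsilon> ^ 2 * real n ^ 2 \<le> X" "\<epsilon> ^ 2 \<le> X"
    using \<epsilon> by (simp_all add: X_def)
  then have \<epsilon>n: "\<epsilon> * real n \<le> 1" using \<epsilon>n2 by simp
  have \<rho>X: "\<rho> ^ n \<le> X" using \<rho>n X by simp
  define \<eta> where "\<eta> = K * (\<epsilon> ^ 2 * real n ^ 2)"
  have \<eta>: "0 \<le> \<eta>" "\<eta> \<le> K * X"
    using \<open>0 \<le> K\<close> X by (auto simp: \<eta>_def intro: mult_left_mono)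
  define e where "e = \<mu> v* matrix_prod Q n - \<pi> - \<epsilon> *\<^sub>R (real n *\<^sub>R u - t + t v* matrix_power P0 n)"
  have "norm e \<le> 2 * C * \<rho> ^ n + C * (2 * C * (\<epsilon> * real n ^ 2 * a) * \<rho> ^ n / \<rho>
        + (C * (\<epsilon> * real n * a + \<eta>) / (1 - \<rho>) * (\<epsilon> * real n * a) + \<eta>) / (1 - \<rho>))"
    unfolding e_def u_def t_def a_def
    by (rule expansion_residual_bound[OF P0 P1 \<pi> \<mu> Z \<rho> decay])
      (use \<epsilon> n Q Q_approx in \<open>auto simp: \<eta>_def\<close>)
  also have "\<dots> \<le> 2 * C * X + C * (2 * C * (1 * a) * X / \<rho>
        + (C * ((a + K) * X) / (1 - \<rho>) * a + K * X) / (1 - \<rho>))"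
  proof -
    have "(\<epsilon> * real n * a + \<eta>) * (\<epsilon> * real n) \<le> (a + K) * X"
    proof -
      have "(\<epsilon> * real n * a + \<eta>) * (\<epsilon> * real n)
          = a * (\<epsilon> ^ 2 * real n ^ 2) + \<eta> * (\<epsilon> * real n)"
        by (simp add: power2_eq_square algebra_simps)
      also have "\<dots> \<le> a * X + K * X * 1"
        using \<open>0 \<le> a\<close> \<eta> X \<epsilon>n \<epsilon> by (intro add_mono mult_left_mono mult_mono) auto
      finally show ?thesis by (simp add: algebra_simps)
    qed
    then have "C / (1 - \<rho>) * ((\<epsilon> * real n * a + \<eta>) * (\<epsilon> * real n)) * a
        \<le> C / (1 - \<rho>) * ((a + K) * X) * a"
      using \<rho> \<open>0 \<le> a\<close> by (intro mult_right_mono mult_left_mono) auto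
    then have "C * (\<epsilon> * real n * a + \<eta>) / (1 - \<rho>) * (\<epsilon> * real n * a)
        \<le> C * ((a + K) * X) / (1 - \<rho>) * a"
      by (simp add: mult_ac)
    moreover have "2 * C * (\<epsilon> * real n ^ 2 * a) * \<rho> ^ n \<le> 2 * C * (1 * a) * X"
      using \<rho> \<rho>X \<epsilon> \<epsilon>n2 \<open>0 \<le> a\<close> by (intro mult_mono mult_left_mono mult_right_mono) auto
    ultimately show ?thesis
      using \<rho> \<rho>X \<eta> by (intro add_mono mult_left_mono divide_right_mono) auto
  qed
  also have "\<dots> = B1 * X"
    unfolding B1_def by (simp add: algebra_simps add_divide_distrib)
  finally have e: "norm e \<le> B1 * X" .
  have u1: "u \<bullet> 1 = 0"
    unfolding u_def by (rule poisson_equation(1)[OF P0 \<pi>(1) Z]) (simp add: dot_lmul_matrix P1)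
  have t1: "t \<bullet> 1 = 0"
    unfolding t_def by (rule poisson_equation(1)[OF P0 \<pi>(1) Z u1])
  \<comment> \<open>The part of the drift absent from the stated expansion decays like
    \<open>\<rho> ^ n\<close> and joins the error.\<close>
  have "norm (\<epsilon> *\<^sub>R (t v* matrix_power P0 n)) \<le> 1 * (C * \<rho> ^ n * norm t)"
    unfolding norm_scaleR using decay[OF t1, of n] \<epsilon> by (intro mult_mono) auto
  also have "\<dots> \<le> C * norm t * X"
    using mult_left_mono[OF \<rho>X, of "C * norm t"] \<rho> by (simp add: mult_ac)
  finally have tX: "norm (\<epsilon> *\<^sub>R (t v* matrix_power P0 n)) \<le> C * norm t * X" .
  have "matrix_power Z 2 = Z ** Z"
    using matrix_power_Suc[of Z 0] matrix_power_Suc[of Z 1] by (simp add: numeral_2_eq_2)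
  then have "(\<mu> v* matrix_prod Q n) \<bullet> r - (\<pi> \<bullet> r + \<epsilon> * real n * ((\<pi> v* P1 v* Z) \<bullet> r)
      - \<epsilon> * ((\<pi> v* P1 v* matrix_power Z 2) \<bullet> r))
      = (e + \<epsilon> *\<^sub>R (t v* matrix_power P0 n)) \<bullet> r"
    by (simp add: e_def u_def t_def vector_matrix_mul_assoc matrix_mul_assoc inner_add_left
        inner_diff_left algebra_simps)
  also have "\<bar>\<dots>\<bar> \<le> norm (e + \<epsilon> *\<^sub>R (t v* matrix_power P0 n)) * norm r"
    by (rule Cauchy_Schwarz_ineq2)
  also have "\<dots> \<le> (B1 * X + C * norm t * X) * norm r"
    by (intro mult_right_mono norm_triangle_le add_mono e tX) auto
  finally show "\<bar>(\<mu> v* matrix_prod Q n) \<bullet> r - (\<pi> \<bullet> r + \<epsilon> * real n * ((\<pi> v* P1 v* Z) \<bullet> r)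
      - \<epsilon> * ((\<pi> v* P1 v* matrix_power Z 2) \<bullet> r))\<bar>
      \<le> ((B1 + C * norm ((\<pi> v* P1 v* Z) v* Z)) * norm r) * (\<epsilon> ^ 2 * real n ^ 3)"
    unfolding X_def t_def u_def by (simp add: algebra_simps)
qed

subsection \<open>Passage to the limit\<close>

lemma closed_stochastic_matrices: "closed {A :: real ^ 's ^ 's. stochastic_matrix A}"
  unfolding stochastic_matrix_def prob_vector_def
  by (intro closed_Collect_conj closed_Collect_all closed_Collect_le closed_Collect_eq continuous_intros)

lemma filterlim_ln_inverse: "filterlim (\<lambda>\<epsilon>::real. ln (1 / \<epsilon>)) at_top (at_right 0)"
  using filterlim_compose[OF ln_at_top filterlim_inverse_at_top_right]
  by (simp add: inverse_eq_divide)

lemma step_count_ge_ln: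
  assumes "filterlim (\<lambda>\<epsilon>. real (n \<epsilon>) / ln (1 / \<epsilon>)) at_top (at_right 0)"
  shows "\<forall>\<^sub>F \<epsilon> in at_right 0. c * ln (1 / \<epsilon>) \<le> real (n \<epsilon>)"
proof -
  have "\<forall>\<^sub>F \<epsilon> in at_right 0. c \<le> real (n \<epsilon>) / ln (1 / \<epsilon>)"
    using assms by (simp add: filterlim_at_top)
  moreover have "\<forall>\<^sub>F \<epsilon>::real in at_right 0. 1 \<le> ln (1 / \<epsilon>)"
    using filterlim_ln_inverse by (simp only: filterlim_at_top)
  ultimately show ?thesis
    by eventually_elim (simp add: pos_le_divide_eq)
qed

text \<open>Since \<open>n\<close> outgrows every multiple of \<open>ln (1 / \<epsilon>)\<close>,
  the multiple \<open>2 / ln (1 / \<rho>)\<close> gives the claim after taking logarithms.\<close>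

lemma geometric_le_square:
  assumes "filterlim (\<lambda>\<epsilon>. real (n \<epsilon>) / ln (1 / \<epsilon>)) at_top (at_right 0)"
    and \<rho>: "0 < \<rho>" "\<rho> < 1"
  shows "\<forall>\<^sub>F \<epsilon> in at_right 0. \<rho> ^ n \<epsilon> \<le> \<epsilon> ^ 2"
  using step_count_ge_ln[OF assms(1), of "2 / ln (1 / \<rho>)"] eventually_at_right_less[of "0::real"]
proof eventually_elim
  case (elim \<epsilon>)
  have "0 < ln (1 / \<rho>)" using \<rho> by simp
  then have "2 * ln (1 / \<epsilon>) \<le> real (n \<epsilon>) * ln (1 / \<rho>)"
    using elim by (simp add: field_simps)
  then have "ln (\<rho> ^ n \<epsilon>) \<le> ln (\<epsilon> ^ 2)"
    using \<rho> elim by (simp add: ln_div ln_realpow)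
  then show ?case
    using \<rho> elim by simp
qed

text \<open>Eventually \<open>n\<close> is at most \<open>\<epsilon> powr (- 1 / 3)\<close>, so the
  product is at most \<open>\<epsilon> powr (1 / 3)\<close>.\<close>

lemma step_count_square_tendsto:
  fixes n :: "real \<Rightarrow> nat"
  assumes "(\<lambda>\<epsilon>. real (n \<epsilon>)) \<in> o[at_right 0](\<lambda>\<epsilon>. \<epsilon> powr (- 1 / 3))"
  shows "((\<lambda>\<epsilon>. \<epsilon> * real (n \<epsilon>) ^ 2) \<longlongrightarrow> 0) (at_right 0)"
proof (rule tendsto_sandwich)
  have pos: "\<forall>\<^sub>F \<epsilon>::real in at_right 0. 0 < \<epsilon>"
    by (rule eventually_at_right_less)
  then show "\<forall>\<^sub>F \<epsilon> in at_right 0. 0 \<le> \<epsilon> * real (n \<epsilon>) ^ 2"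
    by eventually_elim simp
  have "\<forall>\<^sub>F \<epsilon> in at_right 0. norm (real (n \<epsilon>)) \<le> 1 * norm (\<epsilon> powr (- 1 / 3))"
    by (rule landau_o.smallD[OF assms]) simp
  with pos show "\<forall>\<^sub>F \<epsilon> in at_right 0. \<epsilon> * real (n \<epsilon>) ^ 2 \<le> \<epsilon> powr (1 / 3)"
  proof eventually_elim
    case (elim \<epsilon>)
    have "\<epsilon> * real (n \<epsilon>) ^ 2 \<le> \<epsilon> * (\<epsilon> powr (- 1 / 3)) ^ 2"
      using elim by (intro mult_left_mono power_mono) auto
    also have "\<dots> = \<epsilon> powr 1 * (\<epsilon> powr (- 1 / 3) * \<epsilon> powr (- 1 / 3))"
      using elim by (simp add: power2_eq_square)
    also have "\<dots> = \<epsilon> powr (1 / 3)"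
      by (simp only: powr_add[symmetric]) simp
    finally show ?case .
  qed
  show "((\<lambda>\<epsilon>::real. \<epsilon> powr (1 / 3)) \<longlongrightarrow> 0) (at_right 0)"
    by (rule tendsto_zero_powrI[where b = "1 / 3"])
      (auto intro!: tendsto_eq_intros eventually_mono[OF pos])
qed simp

theorem theorem4:
  fixes \<mu> r :: "real ^ 's"
    and P :: "nat \<Rightarrow> real \<Rightarrow> real ^ 's ^ 's"
    and P0 P1 :: "real ^ 's ^ 's"
    and n :: "real \<Rightarrow> nat"
  assumes "prob_vector \<mu>"
    and "\<And>i \<epsilon>. 1 \<le> i \<Longrightarrow> 0 < \<epsilon> \<Longrightarrow> stochastic_matrix (P i \<epsilon>)"
    and "\<And>\<epsilon>. 0 < \<epsilon> \<Longrightarrow> 0 < n \<epsilon>"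
    and "filterlim (\<lambda>\<epsilon>. real (n \<epsilon>) / ln (1 / \<epsilon>)) at_top (at_right 0)"
    and "(\<lambda>\<epsilon>. real (n \<epsilon>)) \<in> o[at_right 0](\<lambda>\<epsilon>. \<epsilon> powr (- 1 / 3))"
    and "(\<lambda>\<epsilon>. SUP i\<in>{1..n \<epsilon>}. row_sum_norm (P i \<epsilon> - (P0 + (\<epsilon> * (real i - 1)) *\<^sub>R P1)))
           \<in> O[at_right 0](\<lambda>\<epsilon>. \<epsilon> ^ 2 * real (n \<epsilon>) ^ 2)"
    and "aperiodic_matrix P0"
    and "irreducible_matrix P0"
  shows "let \<pi> = stationary_distribution P0;
             Z = matrix_inv (mat 1 - P0 + matrix_with_rows \<pi>)
         in (\<lambda>\<epsilon>. (\<mu> v* matrix_prod (\<lambda>j. P j \<epsilon>) (n \<epsilon>)) \<bullet> r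
                 - (\<pi> \<bullet> r
                    + \<epsilon> * real (n \<epsilon>) * ((\<pi> v* P1 v* Z) \<bullet> r)
                    - \<epsilon> * ((\<pi> v* P1 v* matrix_power Z 2) \<bullet> r)))
              \<in> O[at_right 0](\<lambda>\<epsilon>. \<epsilon> ^ 2 * real (n \<epsilon>) ^ 3)"
proof -
  let ?D = "\<lambda>i \<epsilon>. P i \<epsilon> - (P0 + (\<epsilon> * (real i - 1)) *\<^sub>R P1)"
  have pos: "\<forall>\<^sub>F \<epsilon>::real in at_right 0. 0 < \<epsilon>"
    by (rule eventually_at_right_less)
  obtain c where "0 < c" and c: "\<forall>\<^sub>F \<epsilon> in at_right 0.
      norm (SUP i\<in>{1..n \<epsilon>}. row_sum_norm (?D i \<epsilon>)) \<le> c * norm (\<epsilon> ^ 2 * real (n \<epsilon>) ^ 2)"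
    using assms(6) by (elim landau_o.bigE)
  define K where "K = CARD('s) * c"
  have "0 \<le> K" using \<open>0 < c\<close> by (simp add: K_def)
  have approx: "\<forall>\<^sub>F \<epsilon> in at_right 0. \<forall>i\<in>{1..n \<epsilon>}. norm (?D i \<epsilon>) \<le> K * (\<epsilon> ^ 2 * real (n \<epsilon>) ^ 2)"
    using c
  proof eventually_elim
    case (elim \<epsilon>)
    show ?case
    proof
      fix i assume i: "i \<in> {1..n \<epsilon>}"
      \<comment> \<open>The index set is finite, so the supremum is over a bounded set and dominates
        each member.\<close>
      have "row_sum_norm (?D i \<epsilon>) \<le> (SUP i\<in>{1..n \<epsilon>}. row_sum_norm (?D i \<epsilon>))"
        by (rule cSUP_upper[OF i]) simp
      also have "\<dots> \<le> c * (\<epsilon> ^ 2 * real (n \<epsilon>) ^ 2)"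
        using elim by simp
      finally show "norm (?D i \<epsilon>) \<le> K * (\<epsilon> ^ 2 * real (n \<epsilon>) ^ 2)"
        unfolding K_def mult.assoc
        by (intro order_trans[OF norm_le_row_sum_norm] mult_left_mono) auto
    qed
  qed
  note lim = step_count_square_tendsto[OF assms(5)]
  have small: "\<forall>\<^sub>F \<epsilon> in at_right 0. \<epsilon> * real (n \<epsilon>) ^ 2 \<le> 1"
    using order_tendstoD(2)[OF lim, of 1] by (auto elim: eventually_mono)

  \<comment> \<open>At index 1 the first-order term vanishes, so \<open>P0\<close> is a limit of
    stochastic matrices, which form a closed set.\<close>
  have "((\<lambda>\<epsilon>. P 1 \<epsilon> - P0) \<longlongrightarrow> 0) (at_right 0)"
  proof (rule Lim_null_comparison)
    show "\<forall>\<^sub>F \<epsilon> in at_right 0. norm (P 1 \<epsilon> - P0) \<le> K * (\<epsilon> * (\<epsilon> * real (n \<epsilon>) ^ 2))"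
      using approx pos
    proof eventually_elim
      case (elim \<epsilon>)
      then have "1 \<in> {1..n \<epsilon>}" using assms(3)[of \<epsilon>] by auto
      then show ?case using elim by (fastforce simp: power2_eq_square mult.assoc)
    qed
    show "((\<lambda>\<epsilon>. K * (\<epsilon> * (\<epsilon> * real (n \<epsilon>) ^ 2))) \<longlongrightarrow> 0) (at_right 0)"
      by (rule tendsto_eq_intros lim refl | simp)+
  qed
  then have "(P 1 \<longlongrightarrow> P0) (at_right 0)"
    using Lim_null by blast
  moreover have "\<forall>\<^sub>F \<epsilon> in at_right 0. P 1 \<epsilon> \<in> {A. stochastic_matrix A}"
    using pos assms(2) by (auto elim: eventually_mono)
  ultimately have P0: "stochastic_matrix P0"
    using Lim_in_closed_set[OF closed_stochastic_matrices, of "P 1"] by auto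

  \<comment> \<open>Both \<open>P 2 \<epsilon>\<close> and \<open>P0\<close> fix the constant vector, so \<open>\<epsilon> P1\<close> maps it into \<open>O(\<epsilon>\<^sup>2n\<^sup>2)\<close>.\<close>
  have P1: "P1 *v 1 = 0"
  proof -
    \<comment> \<open>Together with \<open>n \<epsilon>\<close> being at least
      \<open>ln (1 / \<epsilon>)\<close>, this puts index 2 in the range of the
      approximation.\<close>
    have "\<forall>\<^sub>F \<epsilon>::real in at_right 0. 2 \<le> ln (1 / \<epsilon>)"
      using filterlim_ln_inverse by (simp only: filterlim_at_top)
    then have "\<forall>\<^sub>F \<epsilon> in at_right 0. norm (P1 *v 1) \<le> K * (\<epsilon> * real (n \<epsilon>) ^ 2) * norm (1 :: real ^ 's)"
      using approx pos step_count_ge_ln[OF assms(4), of 1]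
    proof eventually_elim
      case (elim \<epsilon>)
      then have "2 \<in> {1..n \<epsilon>}" by simp
      then have D: "norm (?D 2 \<epsilon>) \<le> K * (\<epsilon> ^ 2 * real (n \<epsilon>) ^ 2)"
        using elim(2) by blast
      have "P 2 \<epsilon> *v 1 = 1" "P0 *v 1 = 1"
        using assms(2)[of 2 \<epsilon>] elim P0 by (simp_all add: stochastic_matrix_iff)
      then have "?D 2 \<epsilon> *v 1 = - (\<epsilon> *\<^sub>R (P1 *v 1))"
        by (simp add: matrix_vector_mult_diff_rdistrib matrix_vector_mult_add_rdistrib
            scaleR_matrix_vector_assoc[symmetric])
      then have "\<epsilon> * norm (P1 *v 1) = norm (?D 2 \<epsilon> *v 1)"
        using elim by simp
      also have "\<dots> \<le> norm (?D 2 \<epsilon>) * norm (1 :: real ^ 's)"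
        by (rule norm_matrix_vector_mult)
      also have "\<dots> \<le> K * (\<epsilon> ^ 2 * real (n \<epsilon>) ^ 2) * norm (1 :: real ^ 's)"
        by (intro mult_right_mono D) simp
      also have "\<dots> = \<epsilon> * (K * (\<epsilon> * real (n \<epsilon>) ^ 2) * norm (1 :: real ^ 's))"
        by (simp add: power2_eq_square)
      finally show ?case using elim by simp
    qed
    moreover have "((\<lambda>\<epsilon>. K * (\<epsilon> * real (n \<epsilon>) ^ 2) * norm (1 :: real ^ 's)) \<longlongrightarrow> 0) (at_right 0)"
      by (rule tendsto_eq_intros lim refl | simp)+
    ultimately have "norm (P1 *v 1) \<le> 0"
      by (intro tendsto_lowerbound) auto
    then show ?thesis by simp
  qed

  have "\<And>x y. 0 \<le> P0 $ x $ y" using P0 by (simp add: stochastic_matrix_iff)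
  then obtain N where "0 < N" "\<And>x y. 0 < matrix_power P0 N $ x $ y"
    using irreducible_aperiodic_primitive[of P0] assms(7,8) by blast
  then obtain C \<rho> where \<rho>: "0 < C" "0 < \<rho>" "\<rho> < 1"
    and decay: "\<And>v k. v \<bullet> 1 = 0 \<Longrightarrow> norm (v v* matrix_power P0 k) \<le> C * \<rho> ^ k * norm v"
    using primitive_zero_sum_decay[OF P0] by metis
  define \<pi> where "\<pi> = stationary_distribution P0"
  have \<pi>: "prob_vector \<pi>" "\<pi> v* P0 = \<pi>"
    using theI'[OF decay_imp_ex1_stationary[OF P0 \<rho> decay]]
    unfolding \<pi>_def stationary_distribution_def by auto
  define Z where "Z = matrix_inv (mat 1 - P0 + matrix_with_rows \<pi>)"
  have "invertible (mat 1 - P0 + matrix_with_rows \<pi>)"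
    by (rule fundamental_matrix_invertible[OF P0 \<rho>(2,3) decay \<pi>(1)])
  then have Z: "Z ** (mat 1 - P0 + matrix_with_rows \<pi>) = mat 1"
    unfolding Z_def matrix_inv_def invertible_def by (rule someI2_ex) simp
  obtain B where B: "\<And>\<epsilon> n Q. 0 < \<epsilon> \<Longrightarrow> \<epsilon> \<le> 1 \<Longrightarrow> 0 < n \<Longrightarrow> \<epsilon> * real n ^ 2 \<le> 1 \<Longrightarrow> \<rho> ^ n \<le> \<epsilon> ^ 2 \<Longrightarrow>
    (\<forall>i\<ge>1. stochastic_matrix (Q i)) \<Longrightarrow>
    (\<forall>i\<in>{1..n}. norm (Q i - (P0 + (\<epsilon> * (real i - 1)) *\<^sub>R P1)) \<le> K * (\<epsilon> ^ 2 * real n ^ 2)) \<Longrightarrow>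
    \<bar>(\<mu> v* matrix_prod Q n) \<bullet> r - (\<pi> \<bullet> r + \<epsilon> * real n * ((\<pi> v* P1 v* Z) \<bullet> r)
      - \<epsilon> * ((\<pi> v* P1 v* matrix_power Z 2) \<bullet> r))\<bar> \<le> B * (\<epsilon> ^ 2 * real n ^ 3)"
    using expansion_bound[OF P0 P1 \<pi> assms(1) Z \<rho> decay \<open>0 \<le> K\<close>, of r] by blast
  have le_1: "\<forall>\<^sub>F \<epsilon>::real in at_right 0. \<epsilon> \<le> 1"
    by (rule eventually_mono[OF eventually_at_right_real[of 0 1]]) auto
  show ?thesis
    unfolding Let_def \<pi>_def[symmetric] Z_def[symmetric]
  proof (rule landau_o.bigI)
    show "\<forall>\<^sub>F \<epsilon> in at_right 0.
        norm ((\<mu> v* matrix_prod (\<lambda>j. P j \<epsilon>) (n \<epsilon>)) \<bullet> r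
          - (\<pi> \<bullet> r + \<epsilon> * real (n \<epsilon>) * ((\<pi> v* P1 v* Z) \<bullet> r)
            - \<epsilon> * ((\<pi> v* P1 v* matrix_power Z 2) \<bullet> r)))
        \<le> (\<bar>B\<bar> + 1) * norm (\<epsilon> ^ 2 * real (n \<epsilon>) ^ 3)"
      using pos le_1 small approx geometric_le_square[OF assms(4) \<rho>(2,3)]
    proof eventually_elim
      case (elim \<epsilon>)
      have "\<bar>(\<mu> v* matrix_prod (\<lambda>j. P j \<epsilon>) (n \<epsilon>)) \<bullet> r
          - (\<pi> \<bullet> r + \<epsilon> * real (n \<epsilon>) * ((\<pi> v* P1 v* Z) \<bullet> r)
            - \<epsilon> * ((\<pi> v* P1 v* matrix_power Z 2) \<bullet> r))\<bar> \<le> B * (\<epsilon> ^ 2 * real (n \<epsilon>) ^ 3)"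
        by (rule B) (use elim assms(2,3) in auto)
      \<comment> \<open>The sign of \<open>B\<close> is not known, while the O-notation asks for a
        positive constant.\<close>
      also have "\<dots> \<le> (\<bar>B\<bar> + 1) * (\<epsilon> ^ 2 * real (n \<epsilon>) ^ 3)"
        by (rule mult_right_mono) auto
      finally show ?case by simp
    qed
  qed simp
qed

end
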